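(* Let $X=\mathrm{Sp}_{2n}(2)$ and let $\Gamma$ be a code in $J(\mathcal{Q}^-,k)$ such that, for $\Delta\in\Gamma$, $X_\Delta\le X_U$ for some totally isotropic $n$-dimensional subspace $U$ of $V$. Then $\Gamma$ is not $X$-strongly incidence-transitive.
   Context: Let $n\ge2$, $V=\mathbb{F}_2^{2n}$ with a symplectic form $B$, and $X=\mathrm{Sp}_{2n}(2)$ its isometry group. $\mathcal{Q}^-$ is the set of elliptic quadratic forms $\phi:V\to\mathbb{F}_2$ with $\phi(x+y)+\phi(x)+\phi(y)=B(x,y)$; $X$ acts on $\mathcal{Q}^-$ by $\phi^g(x)=\phi(xg^{-1})$. $U$ totally isotropic means $B(U,U)=0$; $X_U$, $X_\Delta$ are setwise stabilisers. $J(\mathcal V,k)$: vertices the $k$-subsets of $\mathcal V$, adjacent iff they meet in $k-1$ points; a code is a nonempty vertex set. $\Gamma$ is $X$-strongly incidence-transitive if $X$ preserves $\Gamma$, is transitive on $\Gamma$, and each $X_\Delta$ ($\Delta\in\Gamma$) is transitive on $\Delta\times(\mathcal{Q}^-\setminus\Delta)$. *)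

theory Defs
  imports "HOL-Analysis.Cartesian_Space" "HOL-Library.Z2" "HOL-Algebra.Group_Action"
    "Graph_Theory.Pair_Digraph"
begin

definition symplectic_form :: "(bit ^ 'm \<Rightarrow> bit ^ 'm \<Rightarrow> bit) \<Rightarrow> bool" where
  "symplectic_form B \<longleftrightarrow>
     (\<forall>x. Vector_Spaces.linear (*s) (*) (\<lambda>y. B x y)) \<and>
     (\<forall>y. Vector_Spaces.linear (*s) (*) (\<lambda>x. B x y)) \<and>
     (\<forall>x. B x x = 0) \<and>
     (\<forall>x. (\<forall>y. B x y = 0) \<longrightarrow> x = 0)"

definition Sp :: "(bit ^ 'm \<Rightarrow> bit ^ 'm \<Rightarrow> bit) \<Rightarrow> (bit ^ 'm \<Rightarrow> bit ^ 'm) monoid" where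
  "Sp B = \<lparr> carrier = {g. Vector_Spaces.linear (*s) (*s) g \<and> bij g \<and>
                         (\<forall>x y. B (g x) (g y) = B x y)},
            monoid.mult = (\<circ>), one = id \<rparr>"

definition totally_isotropic ::
    "(bit ^ 'm \<Rightarrow> bit ^ 'm \<Rightarrow> bit) \<Rightarrow> (bit ^ 'm) set \<Rightarrow> bool" where
  "totally_isotropic B U \<longleftrightarrow> vec.subspace U \<and> (\<forall>x\<in>U. \<forall>y\<in>U. B x y = 0)"

definition quadratic_form :: "(bit ^ 'm \<Rightarrow> bit ^ 'm \<Rightarrow> bit) \<Rightarrow> (bit ^ 'm \<Rightarrow> bit) \<Rightarrow> bool" where
  "quadratic_form B \<phi> \<longleftrightarrow>
     (\<forall>c x. \<phi> (c *s x) = c\<^sup>2 * \<phi> x) \<and> (\<forall>x y. \<phi> (x + y) + \<phi> x + \<phi> y = B x y)"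

definition witt_index :: "(bit ^ 'm \<Rightarrow> bit) \<Rightarrow> nat" where
  "witt_index \<phi> = Max {vec.dim W | W. vec.subspace W \<and> (\<forall>x\<in>W. \<phi> x = 0)}"

text \<open>On a space of dimension \<open>2n\<close>, a form with nondegenerate polarisation has Witt index
  \<open>n\<close> (hyperbolic) or \<open>n - 1\<close> (elliptic).\<close>

definition elliptic_forms :: "(bit ^ 'm \<Rightarrow> bit ^ 'm \<Rightarrow> bit) \<Rightarrow> (bit ^ 'm \<Rightarrow> bit) set" where
  "elliptic_forms B = {\<phi>. quadratic_form B \<phi> \<and> 2 * (witt_index \<phi> + 1) = CARD('m)}"

text \<open>Maps are written on the left here, so \<open>x g\<^sup>-\<^sup>1\<close> becomes the value of the inverse
  map at \<open>x\<close>, and the right action \<open>\<phi>\<^sup>g\<close> becomes a left action of the group of isometries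
  under composition.\<close>

definition form_act :: "(bit ^ 'm \<Rightarrow> bit ^ 'm) \<Rightarrow> (bit ^ 'm \<Rightarrow> bit) \<Rightarrow> bit ^ 'm \<Rightarrow> bit" where
  "form_act g \<phi> = (\<lambda>x. \<phi> (inv_into UNIV g x))"

definition setwise_stabilizer ::
    "('g, 'b) monoid_scheme \<Rightarrow> ('g \<Rightarrow> 'a \<Rightarrow> 'a) \<Rightarrow> 'a set \<Rightarrow> 'g set" where
  "setwise_stabilizer G act S = stabilizer G (\<lambda>g. (`) (act g)) S"

definition johnson_graph :: "'a set \<Rightarrow> nat \<Rightarrow> 'a set pair_pre_digraph" where
  "johnson_graph \<V> k =
     \<lparr> pverts = {\<Delta>. \<Delta> \<subseteq> \<V> \<and> finite \<Delta> \<and> card \<Delta> = k},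
       parcs = {(\<Delta>, \<Delta>'). \<Delta> \<subseteq> \<V> \<and> finite \<Delta> \<and> card \<Delta> = k \<and>
                         \<Delta>' \<subseteq> \<V> \<and> finite \<Delta>' \<and> card \<Delta>' = k \<and> card (\<Delta> \<inter> \<Delta>') + 1 = k} \<rparr>"

definition code_in :: "'a pair_pre_digraph \<Rightarrow> 'a set \<Rightarrow> bool" where
  "code_in J \<Gamma> \<longleftrightarrow> \<Gamma> \<noteq> {} \<and> \<Gamma> \<subseteq> pverts J"

definition transitive_on :: "'g set \<Rightarrow> ('g \<Rightarrow> 'a \<Rightarrow> 'a) \<Rightarrow> 'a set \<Rightarrow> bool" where
  "transitive_on H act A \<longleftrightarrow> (\<forall>a\<in>A. \<forall>b\<in>A. \<exists>h\<in>H. act h a = b)"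

definition strongly_incidence_transitive ::
    "('g, 'b) monoid_scheme \<Rightarrow> ('g \<Rightarrow> 'a \<Rightarrow> 'a) \<Rightarrow> 'a set \<Rightarrow> 'a set set \<Rightarrow> bool" where
  "strongly_incidence_transitive G act \<V> \<Gamma> \<longleftrightarrow>
     (\<forall>g\<in>carrier G. (\<lambda>\<Delta>. act g ` \<Delta>) ` \<Gamma> = \<Gamma>) \<and>
     transitive_on (carrier G) (\<lambda>g \<Delta>. act g ` \<Delta>) \<Gamma> \<and>
     (\<forall>\<Delta>\<in>\<Gamma>. transitive_on (setwise_stabilizer G act \<Delta>)
               (\<lambda>g. map_prod (act g) (act g)) (\<Delta> \<times> (\<V> - \<Delta>)))"

lemma group_Sp: "group (Sp B)"
proof (rule groupI)
  fix g assume "g \<in> carrier (Sp B)"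
  then have g: "Vector_Spaces.linear (*s) (*s) g" "bij g" "\<And>x y. B (g x) (g y) = B x y"
    by (auto simp: Sp_def)
  have "Vector_Spaces.linear (*s) (*s) (inv_into UNIV g)"
  proof
    fix x y and c
    have gi: "g (inv_into UNIV g z) = z" for z
      using g(2) by (simp add: bij_is_surj surj_f_inv_f)
    have inj: "g a = g b \<Longrightarrow> a = b" for a b
      using g(2) by (meson bij_is_inj injD)
    show "inv_into UNIV g (x + y) = inv_into UNIV g x + inv_into UNIV g y"
      by (rule inj) (simp add: gi vec.linear_add[OF g(1)])
    show "inv_into UNIV g (c *s x) = c *s inv_into UNIV g x"
      by (rule inj) (simp add: gi vec.linear_scale[OF g(1)])
  qed
  moreover have "B (inv_into UNIV g x) (inv_into UNIV g y) = B x y" for x y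
    using g(3)[of "inv_into UNIV g x" "inv_into UNIV g y"] g(2)
    by (simp add: bij_is_surj surj_f_inv_f)
  ultimately show "\<exists>h\<in>carrier (Sp B). h \<otimes>\<^bsub>Sp B\<^esub> g = \<one>\<^bsub>Sp B\<^esub>"
    using g(2) by (intro bexI[of _ "inv_into UNIV g"])
      (auto simp: Sp_def bij_imp_bij_inv bij_is_inj)
qed (auto simp: Sp_def comp_assoc bij_comp vec.linear_id intro: Vector_Spaces.linear_compose)

lemma form_act_id: "form_act id \<phi> = \<phi>"
  by (simp add: form_act_def)

lemma form_act_mult:
  assumes "g \<in> carrier (Sp B)" "h \<in> carrier (Sp B)"
  shows "form_act (g \<otimes>\<^bsub>Sp B\<^esub> h) \<phi> = form_act g (form_act h \<phi>)"
  using assms by (auto simp: Sp_def form_act_def o_inv_distrib)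

end

theory Submission imports Defs begin

text \<open>
  An elliptic form restricts to a nonzero linear functional on the maximal totally isotropic
  subspace \<open>U\<close>, and every nonzero functional on \<open>U\<close> arises in this way. Suppose that \<open>X\<^sub>\<Delta>\<close> fixes \<open>U\<close>
  and is transitive on the pairs \<open>(\<phi>, \<psi>)\<close> with \<open>\<phi> \<in> \<Delta>\<close> and \<open>\<psi> \<notin> \<Delta>\<close>. Then \<open>\<phi>\<close> and \<open>\<psi>\<close> never agree on
  \<open>U\<close>, as otherwise all elliptic forms would. So membership in \<open>\<Delta>\<close> depends only on the restriction
  to \<open>U\<close>, and by transitivity the sums \<open>\<phi> + \<psi>\<close> of restrictions lie all in \<open>\<Delta>\<close> or all outside.
  Hence the restrictions of \<open>\<Delta>\<close> or of its complement form, together with 0, a subspace \<open>W\<close> of the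
  dual of \<open>U\<close>. The transvection \<open>x \<mapsto> x + B(x, a) a\<close> sends \<open>\<phi>\<close> to \<open>\<phi> + (1 + \<phi>(a)) B(-, a)\<close>. If \<open>a\<close> is
  chosen such that \<open>B(-, a)\<close> restricts to a nonzero element of \<open>W\<close>, it stabilises \<open>\<Delta>\<close>, but it does not
  fix \<open>U\<close>.
\<close>

section \<open>Additive functions over the field with two elements\<close>

lemma bit_add_self [simp]: "x + x = (0 :: bit)"
  by (cases x) auto

lemma bit_vec_add_self [simp]: "x + x = (0 :: bit ^ 'm)"
  by (simp add: vec_eq_iff)

lemma bit_vec_add_eq_0_iff: "x + y = 0 \<longleftrightarrow> x = (y :: bit ^ 'm)"
  by (metis add.assoc add.left_neutral add.right_neutral bit_vec_add_self)

lemma bit_eq_0_or_1: "x = 0 \<or> x = (1 :: bit)"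
  by (cases x) auto

lemma bit_scale_additive:
  fixes f :: "bit ^ 'm \<Rightarrow> bit"
  assumes "\<forall>x y. f (x + y) = f x + f y"
  shows "f (c *s x) = c * f x"
proof -
  have "f 0 = 0" using assms[rule_format, of 0 0] by simp
  then show ?thesis using bit_eq_0_or_1[of c] by auto
qed

text \<open>The only scalars are 0 and 1, so additivity already gives linearity, and the basis
  expansion determines the function.\<close>

lemma additive_eq_if_eq_on_axis:
  fixes f g :: "bit ^ 'm \<Rightarrow> bit"
  assumes f: "\<forall>x y. f (x + y) = f x + f y" and g: "\<forall>x y. g (x + y) = g x + g y"
    and eq: "\<forall>i. f (axis i 1) = g (axis i 1)"
  shows "f = g"
proof -
  have expand: "h x = (\<Sum>i\<in>UNIV. x $ i * h (axis i 1))"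
    if h: "\<forall>x y. h (x + y) = h x + h y" for h :: "bit ^ 'm \<Rightarrow> bit" and x
  proof -
    have h0: "h 0 = 0" using h[rule_format, of 0 0] by simp
    have "h (\<Sum>i\<in>UNIV. x $ i *s axis i 1) = (\<Sum>i\<in>UNIV. h (x $ i *s axis i 1))"
      using sum_comp_morphism[of h "\<lambda>i. x $ i *s axis i 1" UNIV] h0 h by (simp add: o_def)
    also have "\<dots> = (\<Sum>i\<in>UNIV. x $ i * h (axis i 1))"
      by (simp only: bit_scale_additive[OF h])
    finally show ?thesis by (simp only: basis_expansion)
  qed
  show ?thesis
  proof
    fix x
    show "f x = g x" using expand[OF f, of x] expand[OF g, of x] eq by simp
  qed
qed

section \<open>Quadratic forms and the Witt index\<close>

lemma quadratic_form_add:
  assumes "quadratic_form B \<phi>"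
  shows "\<phi> (x + y) = \<phi> x + \<phi> y + B x y"
proof -
  have "\<phi> (x + y) + \<phi> x + \<phi> y = B x y" using assms by (simp add: quadratic_form_def)
  then show ?thesis by (cases "\<phi> (x + y)"; cases "\<phi> x"; cases "\<phi> y") auto
qed

text \<open>\<open>Max\<close> bounds its elements only for a finite set; here every dimension is at
  most \<open>CARD('m)\<close>.\<close>

lemma witt_index_ge_dim:
  fixes \<phi> :: "bit ^ 'm \<Rightarrow> bit"
  assumes "vec.subspace W" "\<forall>x\<in>W. \<phi> x = 0"
  shows "vec.dim W \<le> witt_index \<phi>"
proof -
  have "{vec.dim W | W. vec.subspace W \<and> (\<forall>x\<in>W. \<phi> x = 0)} \<subseteq> {..CARD('m)}"
    by (auto simp: dim_subset_UNIV_cart_gen)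
  then have "finite {vec.dim W | W. vec.subspace W \<and> (\<forall>x\<in>W. \<phi> x = 0)}"
    by (rule finite_subset) simp
  then show ?thesis
    unfolding witt_index_def using assms by (intro Max_ge) auto
qed

section \<open>The action of the symplectic group on elliptic forms\<close>

lemma Sp_D:
  assumes "g \<in> carrier (Sp B)"
  shows "Vector_Spaces.linear (*s) (*s) g" "bij g" "B (g x) (g y) = B x y"
  using assms by (auto simp: Sp_def)

lemma inv_in_Sp:
  assumes "g \<in> carrier (Sp B)"
  shows "inv_into UNIV g \<in> carrier (Sp B)"
proof -
  interpret group "Sp B" by (rule group_Sp)
  let ?h = "inv\<^bsub>Sp B\<^esub> g"
  have h: "?h \<in> carrier (Sp B)" using assms by simp
  have "g \<circ> ?h = id" using r_inv[OF assms] by (simp add: Sp_def)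
  moreover have "?h \<circ> g = id" using l_inv[OF assms] by (simp add: Sp_def)
  ultimately have "inv_into UNIV g = ?h" by (rule inv_unique_comp)
  with h show ?thesis by simp
qed

text \<open>The image of \<open>W\<close> under \<open>g\<close> is totally singular for the moved
  form and has the same dimension. Applied also to the inverse of \<open>g\<close>, the inclusion
  becomes an equality, so the Witt index is invariant.\<close>

lemma singular_dims_form_act_subset:
  assumes g: "g \<in> carrier (Sp B)"
  shows "{vec.dim W | W. vec.subspace W \<and> (\<forall>x\<in>W. \<phi> x = 0)}
       \<subseteq> {vec.dim W | W. vec.subspace W \<and> (\<forall>x\<in>W. form_act g \<phi> x = 0)}"
proof safe
  fix W assume W: "vec.subspace W" "\<forall>x\<in>W. \<phi> x = 0"
  note lin = Sp_D(1)[OF g] and bij = Sp_D(2)[OF g]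
  have "vec.dim (g ` W) = vec.dim W"
    using lin bij by (intro vec.dim_image_eq) (auto intro: inj_on_subset bij_is_inj)
  moreover have "vec.subspace (g ` W)"
    using vec.linear_subspace_image[OF lin W(1)] .
  moreover have "\<forall>x\<in>g ` W. form_act g \<phi> x = 0"
    using W(2) bij by (auto simp: form_act_def bij_is_inj)
  ultimately show "\<exists>W'. vec.dim W = vec.dim W' \<and> vec.subspace W' \<and> (\<forall>x\<in>W'. form_act g \<phi> x = 0)"
    by metis
qed

lemma form_act_inv:
  assumes "g \<in> carrier (Sp B)"
  shows "form_act (inv_into UNIV g) (form_act g \<phi>) = \<phi>"
  using Sp_D(2)[OF assms] by (simp add: form_act_def inv_inv_eq bij_is_inj)

lemma witt_index_form_act:
  assumes "g \<in> carrier (Sp B)"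
  shows "witt_index (form_act g \<phi>) = witt_index \<phi>"
  using singular_dims_form_act_subset[OF assms, of \<phi>]
    singular_dims_form_act_subset[OF inv_in_Sp[OF assms], of "form_act g \<phi>"]
  unfolding witt_index_def form_act_inv[OF assms] by (metis (no_types, lifting) subset_antisym)

lemma form_act_elliptic:
  assumes g: "g \<in> carrier (Sp B)" and \<phi>: "\<phi> \<in> elliptic_forms B"
  shows "form_act g \<phi> \<in> elliptic_forms B"
proof -
  note h = inv_in_Sp[OF g]
  have "quadratic_form B (form_act g \<phi>)"
    using \<phi> Sp_D(3)[OF h]
    by (simp add: elliptic_forms_def quadratic_form_def form_act_def
        vec.linear_add[OF Sp_D(1)[OF h]] vec.linear_scale[OF Sp_D(1)[OF h]])
  then show ?thesis
    using \<phi> witt_index_form_act[OF g] by (simp add: elliptic_forms_def)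
qed

lemma form_act_inj:
  assumes "g \<in> carrier (Sp B)"
  shows "inj_on (form_act g) A"
  using form_act_inv[OF assms] by (metis inj_onI)

lemma form_act_image_elliptic:
  assumes g: "g \<in> carrier (Sp B)"
  shows "form_act g ` elliptic_forms B = elliptic_forms B"
proof
  show "elliptic_forms B \<subseteq> form_act g ` elliptic_forms B"
  proof
    fix \<phi> assume "\<phi> \<in> elliptic_forms B"
    moreover have "\<phi> = form_act g (form_act (inv_into UNIV g) \<phi>)"
      using form_act_inv[OF inv_in_Sp[OF g]] Sp_D(2)[OF g] by (simp add: inv_inv_eq)
    ultimately show "\<phi> \<in> form_act g ` elliptic_forms B"
      using form_act_elliptic[OF inv_in_Sp[OF g]] by blast
  qed
qed (use form_act_elliptic[OF g] in blast)

lemma setwise_stabilizer_iff: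
  "g \<in> setwise_stabilizer G act S \<longleftrightarrow> g \<in> carrier G \<and> act g ` S = S"
  by (auto simp: setwise_stabilizer_def stabilizer_def)

text \<open>\<open>form_act g\<close> permutes the elliptic forms. This serves the case in which the
  complement of \<open>\<Delta>\<close> is the part closed under sums.\<close>

lemma form_act_image_eq_if_compl:
  assumes "D \<subseteq> elliptic_forms B" "g \<in> carrier (Sp B)"
    and "form_act g ` (elliptic_forms B - D) = elliptic_forms B - D"
  shows "form_act g ` D = D"
proof -
  have "form_act g ` (elliptic_forms B - (elliptic_forms B - D)) = elliptic_forms B - (elliptic_forms B - D)"
    using form_act_image_elliptic[OF assms(2)] assms(3) form_act_inj[OF assms(2)]
    by (subst inj_on_image_set_diff) auto
  then show ?thesis using assms(1) by (simp add: double_diff)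
qed

section \<open>Symplectic spaces, represented functionals and transvections\<close>

definition transvection :: "(bit ^ 'm \<Rightarrow> bit ^ 'm \<Rightarrow> bit) \<Rightarrow> bit ^ 'm \<Rightarrow> bit ^ 'm \<Rightarrow> bit ^ 'm" where
  "transvection B a x = x + B x a *s a"

locale symplectic_space =
  fixes B :: "bit ^ 'm \<Rightarrow> bit ^ 'm \<Rightarrow> bit"
  assumes symplectic: "symplectic_form B"
begin

lemma B_add: "B (x + y) z = B x z + B y z" "B x (y + z) = B x y + B x z"
  using symplectic
  by (auto simp: symplectic_form_def Vector_Spaces.linear_def module_hom_def module_hom_axioms_def)

lemma B_scale: "B (c *s x) z = c * B x z" "B x (c *s z) = c * B x z"
  using symplectic
  by (auto simp: symplectic_form_def Vector_Spaces.linear_def module_hom_def module_hom_axioms_def)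

lemma B_self [simp]: "B x x = 0"
  using symplectic by (simp add: symplectic_form_def)

lemma B_nondegenerate:
  assumes "x \<noteq> 0"
  obtains y where "B x y = 1"
  using symplectic assms unfolding symplectic_form_def by (metis bit_eq_0_or_1)

lemma B_sym: "B x y = B y x"
proof -
  have "B (x + y) (x + y) = 0" by simp
  then show ?thesis unfolding B_add by (cases "B x y"; cases "B y x") auto
qed

text \<open>Nondegeneracy makes \<open>a \<mapsto> B(-, a)\<close> injective, hence surjective onto
  the dual by equality of dimensions.\<close>

lemma additive_represented:
  assumes f: "\<And>x y. f (x + y) = f x + f y"
  obtains a where "\<And>x. f x = B x a"
proof -
  \<comment> \<open>A functional is encoded by its values on the standard basis, which makes
    \<open>L\<close> an endomorphism of the space.\<close>
  define L where "L a = (\<chi> i. B (axis i 1) a)" for a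
  have "inj L"
  proof (rule injI)
    fix a b assume "L a = L b"
    then have "B (axis i 1) a = B (axis i 1) b" for i by (simp add: L_def vec_eq_iff)
    then have eq: "(\<lambda>x. B x a) = (\<lambda>x. B x b)"
      using additive_eq_if_eq_on_axis[of "\<lambda>x. B x a" "\<lambda>x. B x b"] B_add(1) by presburger
    have "B (a + b) x = 0" for x
      using fun_cong[OF eq, of x] unfolding B_add B_sym[of _ x] by simp
    then have "a + b = 0" using B_nondegenerate[of "a + b"] by fastforce
    then show "a = b" by (simp add: bit_vec_add_eq_0_iff)
  qed
  moreover have "Vector_Spaces.linear (*s) (*s) L"
    by unfold_locales (auto simp: L_def vec_eq_iff B_add B_scale)
  ultimately have "surj L" by (intro vec.linear_injective_imp_surjective) auto
  then obtain a where "L a = (\<chi> i. f (axis i 1))" by (metis surjD)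
  then have "f (axis i 1) = B (axis i 1) a" for i by (simp add: L_def vec_eq_iff)
  then have "f = (\<lambda>x. B x a)"
    using additive_eq_if_eq_on_axis[of f "\<lambda>x. B x a"] f B_add(1) by presburger
  then show ?thesis using that by blast
qed

text \<open>Composition with a linear projection \<open>p\<close> onto \<open>U\<close> extends
  \<open>f\<close> from \<open>U\<close> to the whole space.\<close>

lemma additive_on_subspace_represented:
  assumes U: "vec.subspace U" and f: "\<And>x y. x \<in> U \<Longrightarrow> y \<in> U \<Longrightarrow> f (x + y) = f x + f y"
  obtains a where "\<And>x. x \<in> U \<Longrightarrow> f x = B x a"
proof -
  obtain p :: "bit ^ 'm \<Rightarrow> bit ^ 'm" where p: "p ` UNIV \<subseteq> U" "Vector_Spaces.linear (*s) (*s) p" "\<forall>v\<in>U. p (id v) = v"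
    using vec.linear_exists_left_inverse_on[OF vec.linear_id U] by auto
  have "f (p (x + y)) = f (p x) + f (p y)" for x y
    using p(1) f by (simp add: vec.linear_add[OF p(2)] image_subset_iff)
  then obtain a where "\<And>x. f (p x) = B x a"
    using additive_represented[of "\<lambda>x. f (p x)"] by blast
  then show ?thesis using p(3) that by (metis id_apply)
qed

lemma transvection_involution: "transvection B a (transvection B a x) = x"
  using bit_eq_0_or_1[of "B x a"]
  by (auto simp: transvection_def B_add B_scale add.assoc)

lemma transvection_in_Sp: "transvection B a \<in> carrier (Sp B)"
proof -
  have "bij (transvection B a)"
    using transvection_involution by (intro involuntory_imp_bij) auto
  moreover have "Vector_Spaces.linear (*s) (*s) (transvection B a)"
    by unfold_locales (auto simp: transvection_def B_add B_scale vec_eq_iff algebra_simps)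
  moreover have "B (transvection B a x) (transvection B a y) = B x y" for x y
    unfolding transvection_def B_add B_scale B_self B_sym[of a]
    using bit_eq_0_or_1[of "B x a"] bit_eq_0_or_1[of "B y a"] by (auto simp: add.assoc)
  ultimately show ?thesis by (simp add: Sp_def)
qed

text \<open>If \<open>B x a = 1\<close>, then
  \<open>\<phi> (x + a) = \<phi> x + \<phi> a + 1\<close>. So the transvection fixes
  \<open>\<phi>\<close> when \<open>\<phi> a = 1\<close> and adds \<open>B(-, a)\<close> when
  \<open>\<phi> a = 0\<close>.\<close>

lemma form_act_transvection:
  assumes "quadratic_form B \<phi>"
  shows "form_act (transvection B a) \<phi> x = \<phi> x + (1 + \<phi> a) * B x a"
proof -
  have "inv_into UNIV (transvection B a) = transvection B a"
    using transvection_involution by (intro inv_unique_comp) auto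
  then have "form_act (transvection B a) \<phi> x = \<phi> (x + B x a *s a)"
    by (simp add: form_act_def transvection_def)
  then show ?thesis
  proof (cases "B x a")
    case zero
    then show ?thesis using \<open>form_act _ _ _ = _\<close> by simp
  next
    case one
    then show ?thesis
      using \<open>form_act _ _ _ = _\<close> by (simp add: quadratic_form_add[OF assms])
  qed
qed

end

section \<open>Elliptic forms on a maximal totally isotropic subspace\<close>

locale lagrangian = symplectic_space B for B :: "bit ^ 'm \<Rightarrow> bit ^ 'm \<Rightarrow> bit" +
  fixes U :: "(bit ^ 'm) set"
  assumes isotropic: "totally_isotropic B U"
    and dim_U: "2 * vec.dim U = CARD('m)"
begin

abbreviation Q where "Q \<equiv> elliptic_forms B"

lemma subspace_U: "vec.subspace U"
  using isotropic by (simp add: totally_isotropic_def)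

lemma B_zero_on_U: "x \<in> U \<Longrightarrow> y \<in> U \<Longrightarrow> B x y = 0"
  using isotropic by (simp add: totally_isotropic_def)

lemma elliptic_quadratic: "\<phi> \<in> Q \<Longrightarrow> quadratic_form B \<phi>"
  by (simp add: elliptic_forms_def)

lemma elliptic_additive_on_U:
  assumes "\<phi> \<in> Q" "x \<in> U" "y \<in> U"
  shows "\<phi> (x + y) = \<phi> x + \<phi> y"
  using quadratic_form_add[OF elliptic_quadratic[OF assms(1)], of x y] B_zero_on_U[OF assms(2,3)]
  by simp

text \<open>Otherwise \<open>U\<close> would be totally singular, but its dimension exceeds the Witt
  index of an elliptic form by one.\<close>

lemma elliptic_nonzero_on_U:
  assumes "\<phi> \<in> Q"
  obtains u where "u \<in> U" "\<phi> u = 1"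
proof -
  have "\<not> (\<forall>x\<in>U. \<phi> x = 0)"
  proof
    assume "\<forall>x\<in>U. \<phi> x = 0"
    then have "vec.dim U \<le> witt_index \<phi>" by (rule witt_index_ge_dim[OF subspace_U])
    then show False using assms dim_U by (simp add: elliptic_forms_def)
  qed
  then show ?thesis using that by (metis bit_eq_0_or_1)
qed

text \<open>The image of \<open>u\<close> is \<open>u + a\<close>, so invariance would put
  \<open>a\<close> into \<open>U\<close>, against \<open>B u a = 1\<close>.\<close>

lemma transvection_moves_U:
  assumes "u \<in> U" "B u a = 1"
  shows "transvection B a ` U \<noteq> U"
proof
  assume "transvection B a ` U = U"
  then have "u + a \<in> U" using assms by (force simp: transvection_def)
  then have "u + (u + a) \<in> U" using assms(1) vec.subspace_add[OF subspace_U] by blast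
  then have "a \<in> U" by (simp flip: add.assoc)
  then show False using B_zero_on_U[OF assms(1)] assms(2) by simp
qed

text \<open>The transvection along a vector \<open>b\<close> with \<open>\<phi> b = 0\<close> adds
  exactly \<open>B(-, b)\<close> to \<open>\<phi>\<close>. The assumption on \<open>v\<close> says
  that the sum is nonzero on \<open>U\<close>, as every elliptic form must be.\<close>

lemma elliptic_add_functional:
  assumes \<phi>: "\<phi> \<in> Q" and v: "v \<in> U" "B v a \<noteq> \<phi> v"
  obtains \<omega> where "\<omega> \<in> Q" "\<And>x. x \<in> U \<Longrightarrow> \<omega> x = \<phi> x + B x a"
proof -
  note q = elliptic_quadratic[OF \<phi>]
  \<comment> \<open>Adding \<open>v\<close> to \<open>a\<close> leaves \<open>B(-, a)\<close> unchanged on \<open>U\<close> but flips the value of \<open>\<phi>\<close>.\<close>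
  obtain b where b: "\<phi> b = 0" "\<And>x. x \<in> U \<Longrightarrow> B x b = B x a"
  proof (cases "\<phi> a = 0")
    case False
    have "\<phi> (a + v) = 0"
      using False v(2) B_sym[of a v] unfolding quadratic_form_add[OF q]
      by (cases "\<phi> a"; cases "\<phi> v"; cases "B v a") auto
    moreover have "B x (a + v) = B x a" if "x \<in> U" for x
      using B_zero_on_U[OF that v(1)] by (simp add: B_add)
    ultimately show ?thesis using that by blast
  qed (use that in blast)
  show ?thesis
  proof (rule that)
    show "form_act (transvection B b) \<phi> \<in> Q"
      by (rule form_act_elliptic[OF transvection_in_Sp \<phi>])
    show "form_act (transvection B b) \<phi> x = \<phi> x + B x a" if "x \<in> U" for x
      using form_act_transvection[OF q] b that by simp
  qed
qed

text \<open>Together with 0, the restrictions of \<open>D\<close> to \<open>U\<close> form a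
  subspace of the dual. The transvection along a vector representing \<open>\<phi>0\<close> on
  \<open>U\<close> fixes a form of \<open>D\<close> or adds \<open>\<phi>0\<close> to its
  restriction, so it preserves \<open>D\<close>; it moves \<open>U\<close> because
  \<open>\<phi>0\<close> is nonzero there.\<close>

lemma sum_closed_stabilizer_moves_U:
  assumes D: "D \<subseteq> Q" and \<phi>0: "\<phi>0 \<in> D"
    and eq_closed: "\<And>\<phi> \<omega>. \<phi> \<in> D \<Longrightarrow> \<omega> \<in> Q \<Longrightarrow> \<forall>x\<in>U. \<omega> x = \<phi> x \<Longrightarrow> \<omega> \<in> D"
    and sum_closed: "\<And>\<phi> \<psi> \<omega>. \<phi> \<in> D \<Longrightarrow> \<psi> \<in> D \<Longrightarrow> \<omega> \<in> Q \<Longrightarrow>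
          \<forall>x\<in>U. \<omega> x = \<phi> x + \<psi> x \<Longrightarrow> \<omega> \<in> D"
  obtains g where "g \<in> carrier (Sp B)" "form_act g ` D = D" "g ` U \<noteq> U"
proof -
  obtain a where a: "\<And>x. x \<in> U \<Longrightarrow> \<phi>0 x = B x a"
    using additive_on_subspace_represented[OF subspace_U, of \<phi>0]
      elliptic_additive_on_U[of \<phi>0] \<phi>0 D by blast
  let ?t = "transvection B a"
  have maps: "form_act ?t \<phi> \<in> D" if \<phi>: "\<phi> \<in> D" for \<phi>
  proof -
    have q: "\<phi> \<in> Q" using \<phi> D by blast
    note e = form_act_elliptic[OF transvection_in_Sp q, of a]
    note t = form_act_transvection[OF elliptic_quadratic[OF q], of a]
    show ?thesis
    proof (cases "\<phi> a")
      case zero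
      then show ?thesis using sum_closed[OF \<phi> \<phi>0 e] t a by simp
    next
      case one
      then show ?thesis using eq_closed[OF \<phi> e] t by simp
    qed
  qed
  \<comment> \<open>For an involution, mapping \<open>D\<close> into itself is enough for
    equality.\<close>
  have invol: "form_act ?t (form_act ?t \<phi>) = \<phi>" for \<phi>
    using form_act_inv[OF transvection_in_Sp, of a \<phi>] transvection_involution
      inv_unique_comp[of ?t ?t] by (auto simp: fun_eq_iff)
  have "form_act ?t ` D = D"
    using maps invol by (metis (no_types, lifting) image_eqI image_subsetI subsetI subset_antisym)
  moreover obtain u where "u \<in> U" "\<phi>0 u = 1" using elliptic_nonzero_on_U \<phi>0 D by blast
  ultimately show ?thesis
    using that transvection_in_Sp transvection_moves_U a by metis
qed

text \<open>This excludes the empty set and the set of all elliptic forms as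
  \<open>\<Delta>\<close>, since the whole group stabilises both.\<close>

lemma exists_transvection_moving_U:
  assumes "vec.dim U > 0"
  obtains g where "g \<in> carrier (Sp B)" "g ` U \<noteq> U"
proof -
  obtain u where "u \<in> U" "u \<noteq> 0" using assms vec.dim_eq_0[of U] by (metis less_irrefl singleton_iff subsetI)
  then show ?thesis
    using that B_nondegenerate transvection_in_Sp transvection_moves_U by metis
qed

text \<open>A nonzero zero \<open>u\<close> of \<open>\<phi>\<close> in \<open>U\<close> allows
  adding a functional with value 1 at \<open>u\<close>. On a line there is only one nonzero
  functional, hence the bound on the dimension.\<close>

lemma elliptic_forms_differ_on_U:
  assumes \<phi>: "\<phi> \<in> Q" and dim: "vec.dim U \<ge> 2"
  obtains \<omega> where "\<omega> \<in> Q" "\<exists>x\<in>U. \<omega> x \<noteq> \<phi> x"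
proof -
  \<comment> \<open>For independent \<open>v\<close> and \<open>w\<close>, additivity makes
    \<open>\<phi>\<close> vanish at \<open>v\<close>, \<open>w\<close> or
    \<open>v + w\<close>.\<close>
  obtain u where u: "u \<in> U" "u \<noteq> 0" "\<phi> u = 0"
  proof -
    have "\<not> U \<subseteq> vec.span {v}" for v
      using vec.dim_le_card[of U "{v}"] dim by auto
    obtain v where v: "v \<in> U" "v \<noteq> 0" using dim vec.dim_eq_0[of U] by (metis not_numeral_le_zero singleton_iff subsetI)
    obtain w where w: "w \<in> U" "w \<notin> vec.span {v}"
      using \<open>\<not> U \<subseteq> vec.span {v}\<close> by blast
    have "w \<noteq> 0" "w \<noteq> v" using w vec.span_zero vec.span_base by auto
    then have "v + w \<noteq> 0" by (simp add: bit_vec_add_eq_0_iff)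
    show ?thesis
    proof (cases "\<phi> v = 0 \<or> \<phi> w = 0")
      case True
      then show ?thesis using that v w \<open>w \<noteq> 0\<close> by blast
    next
      case False
      then have "\<phi> (v + w) = 0"
        using elliptic_additive_on_U[OF \<phi> v(1) w(1)] by simp
      then show ?thesis
        using that \<open>v + w \<noteq> 0\<close> v w vec.subspace_add[OF subspace_U] by blast
    qed
  qed
  obtain a where a: "B u a = 1" using B_nondegenerate[OF u(2)] .
  then obtain \<omega> where "\<omega> \<in> Q" "\<And>x. x \<in> U \<Longrightarrow> \<omega> x = \<phi> x + B x a"
    using elliptic_add_functional[OF \<phi> u(1)] u(3) by (metis zero_neq_one)
  then show ?thesis using that u a by force
qed

lemma elliptic_sum_exists:
  assumes \<phi>: "\<phi> \<in> Q" and \<psi>: "\<psi> \<in> Q" and v: "v \<in> U" "\<phi> v \<noteq> \<psi> v"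
  obtains \<omega> where "\<omega> \<in> Q" "\<And>x. x \<in> U \<Longrightarrow> \<omega> x = \<phi> x + \<psi> x"
proof -
  obtain a where a: "\<And>x. x \<in> U \<Longrightarrow> \<psi> x = B x a"
    using additive_on_subspace_represented[OF subspace_U, of \<psi>]
      elliptic_additive_on_U[OF \<psi>] by blast
  then show ?thesis
    using elliptic_add_functional[OF \<phi> v(1), of a] v that by metis
qed

text \<open>In characteristic 2, \<open>\<omega> = \<phi> + \<psi>\<close> on \<open>U\<close> means
  \<open>\<psi> = \<phi> + \<omega>\<close>. So if sums across the partition lie in
  \<open>E\<close>, a sum of two forms of \<open>D\<close> cannot lie in \<open>E\<close>, and
  \<open>D\<close> is closed. Either part of a partition can play the role of
  \<open>D\<close>.\<close>

lemma sum_partition_stabilizer_moves_U: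
  assumes D: "D \<subseteq> Q" "D \<noteq> {}" and E: "E = Q - D"
    and sep: "\<And>\<phi> \<psi>. \<phi> \<in> D \<Longrightarrow> \<psi> \<in> E \<Longrightarrow> \<exists>x\<in>U. \<psi> x \<noteq> \<phi> x"
    and sum: "\<And>\<phi> \<psi> \<omega>. \<phi> \<in> D \<Longrightarrow> \<psi> \<in> E \<Longrightarrow> \<omega> \<in> Q \<Longrightarrow>
          \<forall>x\<in>U. \<omega> x = \<phi> x + \<psi> x \<Longrightarrow> \<omega> \<in> E"
  obtains g where "g \<in> carrier (Sp B)" "form_act g ` D = D" "g ` U \<noteq> U"
proof -
  obtain \<phi>0 where \<phi>0: "\<phi>0 \<in> D" using D(2) by blast
  have eq_closed: "\<omega> \<in> D" if "\<phi> \<in> D" "\<omega> \<in> Q" "\<forall>x\<in>U. \<omega> x = \<phi> x" for \<phi> \<omega>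
    using sep[of \<phi> \<omega>] that E by blast
  have sum_closed: "\<omega> \<in> D"
    if "\<phi> \<in> D" "\<psi> \<in> D" "\<omega> \<in> Q" "\<forall>x\<in>U. \<omega> x = \<phi> x + \<psi> x" for \<phi> \<psi> \<omega>
  proof (rule ccontr)
    assume "\<omega> \<notin> D"
    then have "\<omega> \<in> E" using that(3) E by blast
    moreover have "\<forall>x\<in>U. \<psi> x = \<phi> x + \<omega> x" using that(4) by (metis add.assoc add_0 bit_add_self)
    ultimately have "\<psi> \<in> E" using sum that(1,2) D(1) by blast
    then show False using that(2) E by blast
  qed
  show ?thesis
    by (rule sum_closed_stabilizer_moves_U[OF D(1) \<phi>0];
        (fact eq_closed | fact sum_closed | fact that))
qed

section \<open>Transitivity on pairs of a form inside and a form outside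
  \<open>\<Delta>\<close>\<close>

lemma inv_image_in_U:
  assumes g: "g \<in> carrier (Sp B)" "g ` U = U" and x: "x \<in> U"
  shows "inv_into UNIV g x \<in> U"
  using g x Sp_D(2)[OF g(1)] by (metis bij_is_inj image_iff inv_f_f)

lemma pair_transitive_stabilizer_moves_U:
  assumes dim: "vec.dim U \<ge> 2" and D: "\<Delta> \<subseteq> Q"
    and trans: "transitive_on (setwise_stabilizer (Sp B) form_act \<Delta>)
               (\<lambda>g. map_prod (form_act g) (form_act g)) (\<Delta> \<times> (Q - \<Delta>))"
  shows "\<not> setwise_stabilizer (Sp B) form_act \<Delta> \<subseteq> setwise_stabilizer (Sp B) (\<lambda>g. g) U"
proof
  assume sub: "setwise_stabilizer (Sp B) form_act \<Delta> \<subseteq> setwise_stabilizer (Sp B) (\<lambda>g. g) U"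
  have stab: "g ` U = U" if "g \<in> carrier (Sp B)" "form_act g ` \<Delta> = \<Delta>" for g
    using subsetD[OF sub, of g] that by (simp add: setwise_stabilizer_iff)
  have ne: "\<Delta> \<noteq> {}" "\<Delta> \<noteq> Q"
    using exists_transvection_moving_U stab form_act_image_elliptic dim
    by (metis image_empty less_le_trans zero_less_numeral)+
  then obtain \<phi>0 \<psi>0 where 0: "\<phi>0 \<in> \<Delta>" "\<psi>0 \<in> Q - \<Delta>" using D by blast
  have move: "\<exists>g. g \<in> carrier (Sp B) \<and> form_act g ` \<Delta> = \<Delta> \<and> form_act g \<phi> = \<phi>' \<and> form_act g \<psi> = \<psi>'"
    if "\<phi> \<in> \<Delta>" "\<phi>' \<in> \<Delta>" "\<psi> \<in> Q - \<Delta>" "\<psi>' \<in> Q - \<Delta>" for \<phi> \<phi>' \<psi> \<psi>'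
  proof -
    have "\<exists>g\<in>setwise_stabilizer (Sp B) form_act \<Delta>.
        map_prod (form_act g) (form_act g) (\<phi>, \<psi>) = (\<phi>', \<psi>')"
      using trans that unfolding transitive_on_def by blast
    then show ?thesis by (auto simp: setwise_stabilizer_iff)
  qed
  \<comment> \<open>One pair agreeing on \<open>U\<close> would force all pairs to agree, since the
    stabilizer fixes \<open>U\<close>. Forms in \<open>\<Delta>\<close> would then agree with
    \<open>\<phi>0\<close> by way of \<open>\<psi>0\<close>, the others directly.\<close>
  have sep: "\<exists>x\<in>U. \<psi> x \<noteq> \<phi> x" if "\<phi> \<in> \<Delta>" "\<psi> \<in> Q - \<Delta>" for \<phi> \<psi>
  proof (rule ccontr)
    assume eq: "\<not> (\<exists>x\<in>U. \<psi> x \<noteq> \<phi> x)"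
    have all: "\<psi>' x = \<phi>' x" if pair: "\<phi>' \<in> \<Delta>" "\<psi>' \<in> Q - \<Delta>" and "x \<in> U" for \<phi>' \<psi>' x
    proof -
      obtain g where g: "g \<in> carrier (Sp B)" "form_act g ` \<Delta> = \<Delta>"
          "form_act g \<phi> = \<phi>'" "form_act g \<psi> = \<psi>'"
        using move[OF \<open>\<phi> \<in> \<Delta>\<close> pair(1) \<open>\<psi> \<in> Q - \<Delta>\<close> pair(2)] by blast
      show ?thesis
        using eq inv_image_in_U[OF g(1) stab[OF g(1,2)] that(3)]
        unfolding g(3,4)[symmetric] form_act_def by blast
    qed
    have "\<omega> x = \<phi>0 x" if "\<omega> \<in> Q" "x \<in> U" for \<omega> x
      using all[OF _ 0(2) that(2), of \<omega>] all[OF 0 that(2)] all[OF 0(1) _ that(2), of \<omega>] that(1)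
      by (cases "\<omega> \<in> \<Delta>") auto
    moreover have "\<phi>0 \<in> Q" using 0(1) D by blast
    ultimately show False
      using elliptic_forms_differ_on_U[OF _ dim, of \<phi>0] by blast
  qed
  \<comment> \<open>An element moving one pair to the other carries the first sum to the second on
    \<open>U\<close>, and by \<open>sep\<close> membership in \<open>\<Delta>\<close> depends only
    on the restriction to \<open>U\<close>.\<close>
  have sum_invariant: "\<omega>' \<in> \<Delta> \<longleftrightarrow> \<omega> \<in> \<Delta>"
    if pairs: "\<phi> \<in> \<Delta>" "\<phi>' \<in> \<Delta>" "\<psi> \<in> Q - \<Delta>" "\<psi>' \<in> Q - \<Delta>" and \<omega>: "\<omega> \<in> Q" "\<omega>' \<in> Q"
      and eq: "\<forall>x\<in>U. \<omega> x = \<phi> x + \<psi> x" and eq': "\<forall>x\<in>U. \<omega>' x = \<phi>' x + \<psi>' x"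
    for \<phi> \<phi>' \<psi> \<psi>' \<omega> \<omega>'
  proof -
    obtain g where g: "g \<in> carrier (Sp B)" "form_act g ` \<Delta> = \<Delta>"
        "form_act g \<phi> = \<phi>'" "form_act g \<psi> = \<psi>'"
      using move[OF pairs] by blast
    have "form_act g \<omega> x = \<omega>' x" if "x \<in> U" for x
      using bspec[OF eq inv_image_in_U[OF g(1) stab[OF g(1,2)] that]] bspec[OF eq' that]
      unfolding g(3,4)[symmetric] form_act_def by simp
    then have "form_act g \<omega> \<in> \<Delta> \<longleftrightarrow> \<omega>' \<in> \<Delta>"
      using sep[of "form_act g \<omega>" \<omega>'] sep[of \<omega>' "form_act g \<omega>"] \<omega>(2)
        form_act_elliptic[OF g(1) \<omega>(1)] by fastforce
    moreover have "form_act g \<omega> \<in> \<Delta> \<longleftrightarrow> \<omega> \<in> \<Delta>"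
      using inj_image_mem_iff[OF form_act_inj[OF g(1)], of \<omega> \<Delta>] g(2) by simp
    ultimately show ?thesis by blast
  qed
  \<comment> \<open>By \<open>sum_invariant\<close>, the side on which this one sum falls is the
    side of all sums.\<close>
  obtain \<omega>0 where \<omega>0: "\<omega>0 \<in> Q" "\<forall>x\<in>U. \<omega>0 x = \<phi>0 x + \<psi>0 x"
  proof -
    obtain v where v: "v \<in> U" "\<phi>0 v \<noteq> \<psi>0 v" using sep[OF 0] by metis
    have q: "\<phi>0 \<in> Q" "\<psi>0 \<in> Q" using 0 D by auto
    show ?thesis
      by (rule elliptic_sum_exists[OF q v]) (blast intro: that)
  qed
  \<comment> \<open>If the sums fall outside \<open>\<Delta>\<close>, then \<open>\<Delta>\<close>
    is the closed part; if they fall inside, its complement is.\<close>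
  have "\<exists>g. g \<in> carrier (Sp B) \<and> form_act g ` \<Delta> = \<Delta> \<and> g ` U \<noteq> U"
  proof (cases "\<omega>0 \<in> \<Delta>")
    case False
    have sum: "\<omega> \<in> Q - \<Delta>"
      if "\<phi> \<in> \<Delta>" "\<psi> \<in> Q - \<Delta>" "\<omega> \<in> Q" "\<forall>x\<in>U. \<omega> x = \<phi> x + \<psi> x" for \<phi> \<psi> \<omega>
      using sum_invariant[OF 0(1) that(1) 0(2) that(2) \<omega>0(1) that(3) \<omega>0(2) that(4)] False that(3)
      by blast
    show ?thesis
      by (rule sum_partition_stabilizer_moves_U[OF D ne(1) refl];
          (fact sep | fact sum | blast))
  next
    case True
    have sum: "\<omega> \<in> \<Delta>"
      if "\<psi> \<in> Q - \<Delta>" "\<phi> \<in> \<Delta>" "\<omega> \<in> Q" "\<forall>x\<in>U. \<omega> x = \<psi> x + \<phi> x" for \<phi> \<psi> \<omega>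
    proof -
      have "\<forall>x\<in>U. \<omega> x = \<phi> x + \<psi> x" using that(4) by (metis add.commute)
      then show ?thesis
        using sum_invariant[OF 0(1) that(2) 0(2) that(1) \<omega>0(1) that(3) \<omega>0(2)] True by blast
    qed
    have sep': "\<exists>x\<in>U. \<phi> x \<noteq> \<psi> x" if "\<psi> \<in> Q - \<Delta>" "\<phi> \<in> \<Delta>" for \<phi> \<psi>
      using sep[OF that(2,1)] by metis
    have compl: "Q - \<Delta> \<noteq> {}" "\<Delta> = Q - (Q - \<Delta>)" using 0 D by auto
    show ?thesis
    proof (rule sum_partition_stabilizer_moves_U[OF Diff_subset compl])
      fix g assume g: "g \<in> carrier (Sp B)" "form_act g ` (Q - \<Delta>) = Q - \<Delta>" "g ` U \<noteq> U"
      then show ?thesis using form_act_image_eq_if_compl[OF D g(1,2)] by blast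
    qed (fact sep', fact sum)
  qed
  then show False using stab by blast
qed

end

theorem theorem5p24:
  fixes B :: "bit ^ 'm \<Rightarrow> bit ^ 'm \<Rightarrow> bit"
    and n k :: nat
    and \<Gamma> :: "(bit ^ 'm \<Rightarrow> bit) set set"
  assumes "n \<ge> 2"
    and "CARD('m) = 2 * n"
    and "symplectic_form B"
    and "code_in (johnson_graph (elliptic_forms B) k) \<Gamma>"
    and "\<forall>\<Delta>\<in>\<Gamma>. \<exists>U. totally_isotropic B U \<and> vec.dim U = n \<and>
           setwise_stabilizer (Sp B) form_act \<Delta> \<subseteq> setwise_stabilizer (Sp B) (\<lambda>g. g) U"
  shows "\<not> strongly_incidence_transitive (Sp B) form_act (elliptic_forms B) \<Gamma>"
proof
  assume sit: "strongly_incidence_transitive (Sp B) form_act (elliptic_forms B) \<Gamma>"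
  obtain \<Delta> where \<Delta>: "\<Delta> \<in> \<Gamma>" "\<Delta> \<subseteq> elliptic_forms B"
    using assms(4) by (auto simp: code_in_def johnson_graph_def)
  obtain U where U: "totally_isotropic B U" "vec.dim U = n"
      "setwise_stabilizer (Sp B) form_act \<Delta> \<subseteq> setwise_stabilizer (Sp B) (\<lambda>g. g) U"
    using assms(5) \<Delta>(1) by blast
  \<comment> \<open>The dimension \<open>n\<close> of \<open>U\<close> is half of
    \<open>CARD('m)\<close>, as the locale requires.\<close>
  interpret lagrangian B U
    using assms(2,3) U by unfold_locales auto
  show False
    using pair_transitive_stabilizer_moves_U[OF _ \<Delta>(2)] sit \<Delta>(1) U(2,3) assms(1)
    by (auto simp: strongly_incidence_transitive_def)
qed

end
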